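(* Let $s,r\in\mathbb N_+$, $\lambda\in\mathbb R$, and let $(a^{(\ell)}_{ij})_{i,j=1}^s,(b^{(\ell)}_i)_{i=1}^s$ for $\ell=1,\dots,6$ and $(\tilde a^{(\ell)}_{mi})_{m,i=1}^r,(\tilde b^{(\ell)}_m)_{m=1}^r$, $(\bar a^{(\ell)}_{mi})_{m,i=1}^r,(\bar b^{(\ell)}_m)_{m=1}^r$ for $\ell=1,2$ be real coefficients. Consider the partitioned Runge--Kutta method for the stochastic Maxwell equation given, for $1\le k,l,n\le s$ and $1\le m\le r$, by the spatial relations \begin{align*} &\mathscr D_1\mathbf H^m_{kln}=\mathscr D_1\mathbf H^m_{0ln}+\Delta x\sum_{j=1}^sa^{(1)}_{kj}\mathscr D_1(\delta_x\mathbf H)^m_{jln},\qquad \mathscr D_1\mathbf H^m_{1ln}=\mathscr D_1\mathbf H^m_{0ln}+\Delta x\sum_{k=1}^sb^{(1)}_k\mathscr D_1(\delta_x\mathbf H)^m_{kln},\\ &\mathscr D_2\mathbf H^m_{kln}=\mathscr D_2\mathbf H^m_{k0n}+\Delta y\sum_{j=1}^sa^{(2)}_{lj}\mathscr D_2(\delta_y\mathbf H)^m_{kjn},\qquad \mathscr D_2\mathbf H^m_{k1n}=\mathscr D_2\mathbf H^m_{k0n}+\Delta y\sum_{l=1}^sb^{(2)}_l\mathscr D_2(\delta_y\mathbf H)^m_{kln},\\ &\mathscr D_3\mathbf H^m_{kln}=\mathscr D_3\mathbf H^m_{kl0}+\Delta z\sum_{j=1}^sa^{(3)}_{nj}\mathscr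 D_3(\delta_z\mathbf H)^m_{klj},\qquad \mathscr D_3\mathbf H^m_{kl1}=\mathscr D_3\mathbf H^m_{kl0}+\Delta z\sum_{n=1}^sb^{(3)}_n\mathscr D_3(\delta_z\mathbf H)^m_{kln},\\ &\mathscr D_1\mathbf E^m_{kln}=\mathscr D_1\mathbf E^m_{0ln}+\Delta x\sum_{j=1}^sa^{(4)}_{kj}\mathscr D_1(\delta_x\mathbf E)^m_{jln},\qquad \mathscr D_1\mathbf E^m_{1ln}=\mathscr D_1\mathbf E^m_{0ln}+\Delta x\sum_{k=1}^sb^{(4)}_k\mathscr D_1(\delta_x\mathbf E)^m_{kln},\\ &\mathscr D_2\mathbf E^m_{kln}=\mathscr D_2\mathbf E^m_{k0n}+\Delta y\sum_{j=1}^sa^{(5)}_{lj}\mathscr D_2(\delta_y\mathbf E)^m_{kjn},\qquad \mathscr D_2\mathbf E^m_{k1n}=\mathscr D_2\mathbf E^m_{k0n}+\Delta y\sum_{l=1}^sb^{(5)}_l\mathscr D_2(\delta_y\mathbf E)^m_{kln},\\ &\mathscr D_3\mathbf E^m_{kln}=\mathscr D_3\mathbf E^m_{kl0}+\Delta z\sum_{j=1}^sa^{(6)}_{nj}\mathscr D_3(\delta_z\mathbf E)^m_{klj},\qquad \mathscr D_3\mathbf E^m_{kl1}=\mathscr D_3\mathbf E^m_{kl0}+\Delta z\sum_{n=1}^sb^{(6)}_n\mathscr D_3(\delta_z\mathbf E)^m_{kln}, \end{align*} and the temporal relations, with $C(\mathbf X)^m_{kln}:=\mathscr D_1(\delta_x\mathbf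 X)^m_{kln}+\mathscr D_2(\delta_y\mathbf X)^m_{kln}+\mathscr D_3(\delta_z\mathbf X)^m_{kln}$ for $\mathbf X\in\{\mathbf E,\mathbf H\}$, \begin{align*} &\mathbf H^m_{kln}=\mathbf H^0_{kln}-\Delta t\sum_{i=1}^r\tilde a^{(1)}_{mi}C(\mathbf E)^i_{kln}+\lambda\,\Delta W^1_{kln}\sum_{i=1}^r\bar a^{(1)}_{mi}\mathbf E^i_{kln},\\ &\mathbf E^m_{kln}=\mathbf E^0_{kln}+\Delta t\sum_{i=1}^r\tilde a^{(2)}_{mi}C(\mathbf H)^i_{kln}-\lambda\,\Delta W^1_{kln}\sum_{i=1}^r\bar a^{(2)}_{mi}\mathbf H^i_{kln},\\ &\mathbf H^1_{kln}=\mathbf H^0_{kln}-\Delta t\sum_{m=1}^r\tilde b^{(1)}_mC(\mathbf E)^m_{kln}+\lambda\,\Delta W^1_{kln}\sum_{m=1}^r\bar b^{(1)}_m\mathbf E^m_{kln},\\ &\mathbf E^1_{kln}=\mathbf E^0_{kln}+\Delta t\sum_{m=1}^r\tilde b^{(2)}_mC(\mathbf H)^m_{kln}-\lambda\,\Delta W^1_{kln}\sum_{m=1}^r\bar b^{(2)}_m\mathbf H^m_{kln}. \end{align*} Suppose that for all $1\le i,m\le r$ \begin{align*} &\tilde a^{(2)}_{mi}\tilde b^{(1)}_m+\tilde b^{(2)}_i\tilde a^{(1)}_{im}-\tilde b^{(2)}_i\tilde b^{(1)}_m=0,\qquad \bar a^{(2)}_{mi}\tilde b^{(1)}_m+\bar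 b^{(2)}_i\tilde a^{(1)}_{im}-\bar b^{(2)}_i\tilde b^{(1)}_m=0,\\ &\tilde a^{(2)}_{mi}\bar b^{(1)}_m+\tilde b^{(2)}_i\bar a^{(1)}_{im}-\tilde b^{(2)}_i\bar b^{(1)}_m=0,\qquad \bar a^{(2)}_{mi}\bar b^{(1)}_m+\bar b^{(2)}_i\bar a^{(1)}_{im}-\bar b^{(2)}_i\bar b^{(1)}_m=0, \end{align*} that $a^{(\ell)}_{kj}b^{(\ell)}_k+b^{(\ell)}_ja^{(\ell)}_{jk}-b^{(\ell)}_jb^{(\ell)}_k=0$ for all $1\le j,k\le s$ and $\ell=1,\dots,6$, and that $b^{(1)}_k=b^{(4)}_k$, $b^{(2)}_k=b^{(5)}_k$, $b^{(3)}_k=b^{(6)}_k$ for $1\le k\le s$ and $\tilde b^{(1)}_m=\tilde b^{(2)}_m$ for $1\le m\le r$. Then the method satisfies, almost surely, the discrete multi-symplectic conservation law \begin{align*} &\frac1{\Delta t}\sum_{k,l,n=1}^sb^{(1)}_kb^{(2)}_lb^{(3)}_n\big(\mathrm d\mathbf E^1_{kln}\wedge\mathrm d\mathbf H^1_{kln}-\mathrm d\mathbf E^0_{kln}\wedge\mathrm d\mathbf H^0_{kln}\big)\\ &+\frac1{2\Delta x}\sum_{m=1}^r\sum_{l,n=1}^s\tilde b^{(1)}_mb^{(2)}_lb^{(3)}_n\big(\mathrm d\mathbf U^m_{1ln}\wedge K_1\mathrm d\mathbf U^m_{1ln}-\mathrm d\mathbf U^m_{0ln}\wedge K_1\mathrm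 d\mathbf U^m_{0ln}\big)\\ &+\frac1{2\Delta y}\sum_{m=1}^r\sum_{k,n=1}^s\tilde b^{(1)}_mb^{(1)}_kb^{(3)}_n\big(\mathrm d\mathbf U^m_{k1n}\wedge K_2\mathrm d\mathbf U^m_{k1n}-\mathrm d\mathbf U^m_{k0n}\wedge K_2\mathrm d\mathbf U^m_{k0n}\big)\\ &+\frac1{2\Delta z}\sum_{m=1}^r\sum_{k,l=1}^s\tilde b^{(1)}_mb^{(1)}_kb^{(2)}_l\big(\mathrm d\mathbf U^m_{kl1}\wedge K_3\mathrm d\mathbf U^m_{kl1}-\mathrm d\mathbf U^m_{kl0}\wedge K_3\mathrm d\mathbf U^m_{kl0}\big)=0, \end{align*} where $\mathbf U=(\mathbf H^\top,\mathbf E^\top)^\top$ with the same indices.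
   Context: The stochastic Maxwell equation with multiplicative noise is $d\mathbf E=\nabla\times\mathbf H\,dt-\lambda\mathbf H\circ dW(t)$, $d\mathbf H=-\nabla\times\mathbf E\,dt+\lambda\mathbf E\circ dW(t)$, with $\mathbf E,\mathbf H$ $\mathbb R^3$-valued and $W$ a real $L^2$-valued $Q$-Wiener process with trace-class $Q$. Matrices: $$\mathscr D_1=\begin{pmatrix}0&0&0\\0&0&-1\\0&1&0\end{pmatrix},\quad \mathscr D_2=\begin{pmatrix}0&0&1\\0&0&0\\-1&0&0\end{pmatrix},\quad \mathscr D_3=\begin{pmatrix}0&-1&0\\1&0&0\\0&0&0\end{pmatrix},\quad K_i=\begin{pmatrix}\mathscr D_i&0\\0&\mathscr D_i\end{pmatrix},$$ so that $\nabla\times\mathbf X=\mathscr D_1\mathbf X_x+\mathscr D_2\mathbf X_y+\mathscr D_3\mathbf X_z$. The method treats one cell $[0,\Delta x]\times[0,\Delta y]\times[0,\Delta z]\times[0,\Delta t]$. All quantities are vectors in $\mathbb R^3$ (or $\mathbb R^6$ for $\mathbf U$) for each realization of the noise. $\mathbf X^m_{kln}$ (with $m$ a temporal stage index) approximates $\mathbf X$ at spatial stages $k,l,n$ in the $x,y,z$ directions and temporal stage $m$; $(\delta_x\mathbf X)^m_{kln}$, $(\delta_y\mathbf X)^m_{kln}$, $(\delta_z\mathbf X)^m_{kln}$ are the stage quantities discretizing the partial derivatives. $\mathbf X^0_{kln},\mathbf X^1_{kln}$ refer to times $0,\Delta t$ at the spatial stage point; $\mathbf X^m_{0ln},\mathbf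 X^m_{1ln}$ refer to $x=0,\Delta x$ at temporal stage $m$, and analogously for the $y$- and $z$-indices. Boundary values with index $0$ or $1$ are families distinct from the stage values even if indices coincide numerically. $\Delta W^1_{kln}$ is the (real-valued) increment of $W$ over $[0,\Delta t]$ at the spatial stage point $(k,l,n)$. $\mathrm d$ (roman) is the exterior derivative: for a fixed realization of the noise, all numerical quantities are regarded as differentiable functions of parameters (e.g. the data), so their differentials satisfy the linearized scheme and noise increments carry no differential. $\mathrm d\mathbf E\wedge\mathrm d\mathbf H=\sum_{i=1}^3\mathrm dE_i\wedge\mathrm dH_i$ and $\mathrm d\mathbf U\wedge K\mathrm d\mathbf U=\sum_{p,q}K_{pq}\,\mathrm dU_p\wedge\mathrm dU_q$. Note that the latter, for $K=K_i$, involves only the components of $\mathbf U$ determined by $\mathscr D_i\mathbf H$ and $\mathscr D_i\mathbf E$. *)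

theory Defs
  imports "HOL-Probability.Probability"
begin

text \<open>
  Elements of $L^2(D)$ are represented by square-integrable functions; equality in $L^2(D)$
  is equality almost everywhere on \<open>D\<close>.
\<close>

definition L2_on :: "(real ^ 3) set \<Rightarrow> (real ^ 3 \<Rightarrow> real) \<Rightarrow> bool" where
  "L2_on D f \<longleftrightarrow> f \<in> borel_measurable (lebesgue_on D) \<and> integrable (lebesgue_on D) (\<lambda>x. (f x)\<^sup>2)"

definition L2_inner :: "(real ^ 3) set \<Rightarrow> (real ^ 3 \<Rightarrow> real) \<Rightarrow> (real ^ 3 \<Rightarrow> real) \<Rightarrow> real" where
  "L2_inner D f g = integral\<^sup>L (lebesgue_on D) (\<lambda>x. f x * g x)"

definition L2_orthonormal_basis :: "(real ^ 3) set \<Rightarrow> (nat \<Rightarrow> real ^ 3 \<Rightarrow> real) \<Rightarrow> bool" where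
  "L2_orthonormal_basis D e \<longleftrightarrow>
     (\<forall>i. L2_on D (e i)) \<and>
     (\<forall>i j. L2_inner D (e i) (e j) = (if i = j then 1 else 0)) \<and>
     (\<forall>f. L2_on D f \<longrightarrow> (\<forall>i. L2_inner D f (e i) = 0) \<longrightarrow> (AE x in lebesgue_on D. f x = 0))"

definition brownian_motion :: "'w measure \<Rightarrow> (real \<Rightarrow> 'w \<Rightarrow> real) \<Rightarrow> bool" where
  "brownian_motion M B \<longleftrightarrow>
     (\<forall>t\<ge>0. B t \<in> borel_measurable M) \<and>
     (AE \<omega> in M. B 0 \<omega> = 0) \<and>
     (\<forall>\<tau> :: nat \<Rightarrow> real. 0 \<le> \<tau> 0 \<longrightarrow> mono \<tau> \<longrightarrow>
        prob_space.indep_vars M (\<lambda>_. borel) (\<lambda>j \<omega>. B (\<tau> (Suc j)) \<omega> - B (\<tau> j) \<omega>) UNIV) \<and>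
     (\<forall>u t. 0 \<le> u \<longrightarrow> u < t \<longrightarrow>
        distributed M lborel (\<lambda>\<omega>. B t \<omega> - B u \<omega>) (normal_density 0 (sqrt (t - u)))) \<and>
     (AE \<omega> in M. continuous_on {0..} (\<lambda>t. B t \<omega>))"

text \<open>
  A \<open>Q\<close>-Wiener process on $L^2(D)$ with symmetric nonnegative trace-class covariance \<open>Q\<close>, in
  Karhunen--Loeve form $W(t) = \sum_i \sqrt{q_i}\, \beta_i(t)\, e_i$, where \<open>e\<close> is an orthonormal
  eigenbasis of \<open>Q\<close>, the eigenvalues \<open>q\<close> are nonnegative with finite sum (the trace), and the
  Brownian motions \<open>\<beta>\<close> are independent as processes. The identities
  $\langle Q f, e_i\rangle = q_i \langle f, e_i\rangle$ determine \<open>Q f\<close> in $L^2(D)$ for every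
  \<open>f\<close>. Since the scheme evaluates \<open>W\<close> at points, \<open>W t \<omega>\<close> is a representative
  whose point values are random variables.
\<close>

definition Q_Wiener_process ::
  "'w measure \<Rightarrow> (real ^ 3) set \<Rightarrow> ((real ^ 3 \<Rightarrow> real) \<Rightarrow> (real ^ 3 \<Rightarrow> real)) \<Rightarrow>
   (real \<Rightarrow> 'w \<Rightarrow> real ^ 3 \<Rightarrow> real) \<Rightarrow> bool" where
  "Q_Wiener_process M D Q W \<longleftrightarrow>
     (\<forall>t\<ge>0. \<forall>x\<in>D. (\<lambda>\<omega>. W t \<omega> x) \<in> borel_measurable M) \<and>
     (\<exists>e q \<beta>.
        L2_orthonormal_basis D e \<and>
        (\<forall>i. 0 \<le> q i) \<and> summable q \<and>
        (\<forall>f. L2_on D f \<longrightarrow> L2_on D (Q f) \<and> (\<forall>i. L2_inner D (Q f) (e i) = q i * L2_inner D f (e i))) \<and>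
        (\<forall>i. brownian_motion M (\<beta> i)) \<and>
        prob_space.indep_vars M (\<lambda>_. Pi\<^sub>M {0..} (\<lambda>_. borel))
          (\<lambda>i \<omega>. restrict (\<lambda>t. \<beta> i t \<omega>) {0..}) (UNIV :: nat set) \<and>
        (AE \<omega> in M. \<forall>t\<ge>0. L2_on D (W t \<omega>) \<and>
           (\<lambda>N. integral\<^sup>L (lebesgue_on D)
              (\<lambda>x. (W t \<omega> x - (\<Sum>i<N. sqrt (q i) * \<beta> i t \<omega> * e i x))\<^sup>2)) \<longlonglongrightarrow> 0))"

definition D1 :: "real ^ 3 ^ 3" where
  "D1 = vector [vector [0, 0, 0], vector [0, 0, - 1], vector [0, 1, 0]]"

definition D2 :: "real ^ 3 ^ 3" where
  "D2 = vector [vector [0, 0, 1], vector [0, 0, 0], vector [- 1, 0, 0]]"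

definition D3 :: "real ^ 3 ^ 3" where
  "D3 = vector [vector [0, - 1, 0], vector [1, 0, 0], vector [0, 0, 0]]"

text \<open>
  $\mathbb R^6 = \mathbb R^3 \times \mathbb R^3$ is indexed by \<open>3 + 3\<close>, so that the \<open>Inl\<close>
  components are those of $\mathbf H$ and the \<open>Inr\<close> components those of $\mathbf E$.
\<close>

definition stack :: "real ^ 3 \<Rightarrow> real ^ 3 \<Rightarrow> real ^ (3 + 3)" where
  "stack h e = (\<chi> p. case p of Inl i \<Rightarrow> h $ i | Inr i \<Rightarrow> e $ i)"

definition block_diag :: "real ^ 3 ^ 3 \<Rightarrow> real ^ (3 + 3) ^ (3 + 3)" where
  "block_diag A = (\<chi> p q. case p of
       Inl i \<Rightarrow> (case q of Inl j \<Rightarrow> A $ i $ j | Inr _ \<Rightarrow> 0)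
     | Inr i \<Rightarrow> (case q of Inl _ \<Rightarrow> 0 | Inr j \<Rightarrow> A $ i $ j))"

definition K1 :: "real ^ (3 + 3) ^ (3 + 3)" where "K1 = block_diag D1"
definition K2 :: "real ^ (3 + 3) ^ (3 + 3)" where "K2 = block_diag D2"
definition K3 :: "real ^ (3 + 3) ^ (3 + 3)" where "K3 = block_diag D3"

text \<open>
  Forms on the parameter space are given by their values at a base point \<open>\<theta>\<close> on tangent vectors
  \<open>\<xi>\<close>, \<open>\<eta>\<close>.
\<close>

definition ext_d :: "('p::real_normed_vector \<Rightarrow> real) \<Rightarrow> 'p \<Rightarrow> 'p \<Rightarrow> real" where
  "ext_d f \<theta> = frechet_derivative f (at \<theta>)"

definition wedge :: "('p \<Rightarrow> real) \<Rightarrow> ('p \<Rightarrow> real) \<Rightarrow> 'p \<Rightarrow> 'p \<Rightarrow> real" where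
  "wedge \<alpha> \<beta> \<xi> \<eta> = \<alpha> \<xi> * \<beta> \<eta> - \<alpha> \<eta> * \<beta> \<xi>"

text \<open>\<open>wedge_vec X Y\<close> is $\mathrm dX \wedge \mathrm dY$ and \<open>wedge_mat K U\<close> is $\mathrm dU \wedge K\,\mathrm dU$.\<close>

definition wedge_vec ::
  "('p::real_normed_vector \<Rightarrow> real ^ 'n) \<Rightarrow> ('p \<Rightarrow> real ^ 'n) \<Rightarrow> 'p \<Rightarrow> 'p \<Rightarrow> 'p \<Rightarrow> real" where
  "wedge_vec X Y \<theta> \<xi> \<eta> =
     (\<Sum>i\<in>UNIV. wedge (ext_d (\<lambda>\<theta>'. X \<theta>' $ i) \<theta>) (ext_d (\<lambda>\<theta>'. Y \<theta>' $ i) \<theta>) \<xi> \<eta>)"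

definition wedge_mat ::
  "real ^ 'n ^ 'n \<Rightarrow> ('p::real_normed_vector \<Rightarrow> real ^ 'n) \<Rightarrow> 'p \<Rightarrow> 'p \<Rightarrow> 'p \<Rightarrow> real" where
  "wedge_mat K U \<theta> \<xi> \<eta> =
     (\<Sum>p\<in>UNIV. \<Sum>q\<in>UNIV.
        K $ p $ q * wedge (ext_d (\<lambda>\<theta>'. U \<theta>' $ p) \<theta>) (ext_d (\<lambda>\<theta>'. U \<theta>' $ q) \<theta>) \<xi> \<eta>)"

text \<open>
  All numerical quantities attached to one vector field $\mathbf X$. Index order: \<open>stage F m k l n\<close>
  is $\mathbf X^m_{kln}$, and \<open>delx\<close>, \<open>dely\<close>, \<open>delz\<close> are the stage quantities for the partial
  derivatives; \<open>x0 F m l n\<close> and \<open>x1 F m l n\<close> are $\mathbf X^m_{0ln}$ and $\mathbf X^m_{1ln}$,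
  \<open>y0 F m k n\<close> is $\mathbf X^m_{k0n}$, \<open>z0 F m k l\<close> is $\mathbf X^m_{kl0}$, and
  \<open>t0 F k l n\<close>, \<open>t1 F k l n\<close> are $\mathbf X^0_{kln}$, $\mathbf X^1_{kln}$. Thus the boundary
  values are separate from the stage values. Stage indices start at 1.
\<close>

record cell_field =
  stage :: "nat \<Rightarrow> nat \<Rightarrow> nat \<Rightarrow> nat \<Rightarrow> real ^ 3"
  delx :: "nat \<Rightarrow> nat \<Rightarrow> nat \<Rightarrow> nat \<Rightarrow> real ^ 3"
  dely :: "nat \<Rightarrow> nat \<Rightarrow> nat \<Rightarrow> nat \<Rightarrow> real ^ 3"
  delz :: "nat \<Rightarrow> nat \<Rightarrow> nat \<Rightarrow> nat \<Rightarrow> real ^ 3"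
  x0 :: "nat \<Rightarrow> nat \<Rightarrow> nat \<Rightarrow> real ^ 3"
  x1 :: "nat \<Rightarrow> nat \<Rightarrow> nat \<Rightarrow> real ^ 3"
  y0 :: "nat \<Rightarrow> nat \<Rightarrow> nat \<Rightarrow> real ^ 3"
  y1 :: "nat \<Rightarrow> nat \<Rightarrow> nat \<Rightarrow> real ^ 3"
  z0 :: "nat \<Rightarrow> nat \<Rightarrow> nat \<Rightarrow> real ^ 3"
  z1 :: "nat \<Rightarrow> nat \<Rightarrow> nat \<Rightarrow> real ^ 3"
  t0 :: "nat \<Rightarrow> nat \<Rightarrow> nat \<Rightarrow> real ^ 3"
  t1 :: "nat \<Rightarrow> nat \<Rightarrow> nat \<Rightarrow> real ^ 3"

definition differentiable_field ::
  "nat \<Rightarrow> nat \<Rightarrow> ('p::real_normed_vector \<Rightarrow> cell_field) \<Rightarrow> 'p \<Rightarrow> bool" where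
  "differentiable_field s r F \<theta> \<longleftrightarrow>
     (\<forall>m\<in>{1..r}. \<forall>k\<in>{1..s}. \<forall>l\<in>{1..s}. \<forall>n\<in>{1..s}.
        (\<lambda>\<theta>'. stage (F \<theta>') m k l n) differentiable (at \<theta>) \<and>
        (\<lambda>\<theta>'. delx (F \<theta>') m k l n) differentiable (at \<theta>) \<and>
        (\<lambda>\<theta>'. dely (F \<theta>') m k l n) differentiable (at \<theta>) \<and>
        (\<lambda>\<theta>'. delz (F \<theta>') m k l n) differentiable (at \<theta>)) \<and>
     (\<forall>m\<in>{1..r}. \<forall>i\<in>{1..s}. \<forall>j\<in>{1..s}.
        (\<lambda>\<theta>'. x0 (F \<theta>') m i j) differentiable (at \<theta>) \<and>
        (\<lambda>\<theta>'. x1 (F \<theta>') m i j) differentiable (at \<theta>) \<and>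
        (\<lambda>\<theta>'. y0 (F \<theta>') m i j) differentiable (at \<theta>) \<and>
        (\<lambda>\<theta>'. y1 (F \<theta>') m i j) differentiable (at \<theta>) \<and>
        (\<lambda>\<theta>'. z0 (F \<theta>') m i j) differentiable (at \<theta>) \<and>
        (\<lambda>\<theta>'. z1 (F \<theta>') m i j) differentiable (at \<theta>)) \<and>
     (\<forall>k\<in>{1..s}. \<forall>l\<in>{1..s}. \<forall>n\<in>{1..s}.
        (\<lambda>\<theta>'. t0 (F \<theta>') k l n) differentiable (at \<theta>) \<and>
        (\<lambda>\<theta>'. t1 (F \<theta>') k l n) differentiable (at \<theta>))"

definition spatial_relations ::
  "nat \<Rightarrow> nat \<Rightarrow> real \<Rightarrow> real \<Rightarrow> real \<Rightarrow>
   (nat \<Rightarrow> nat \<Rightarrow> real) \<Rightarrow> (nat \<Rightarrow> real) \<Rightarrow> (nat \<Rightarrow> nat \<Rightarrow> real) \<Rightarrow> (nat \<Rightarrow> real) \<Rightarrow>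
   (nat \<Rightarrow> nat \<Rightarrow> real) \<Rightarrow> (nat \<Rightarrow> real) \<Rightarrow> cell_field \<Rightarrow> bool" where
  "spatial_relations s r \<Delta>x \<Delta>y \<Delta>z ax bx ay by az bz F \<longleftrightarrow>
     (\<forall>m\<in>{1..r}. \<forall>k\<in>{1..s}. \<forall>l\<in>{1..s}. \<forall>n\<in>{1..s}.
        D1 *v stage F m k l n = D1 *v x0 F m l n + \<Delta>x *\<^sub>R (\<Sum>j=1..s. ax k j *\<^sub>R (D1 *v delx F m j l n)) \<and>
        D1 *v x1 F m l n = D1 *v x0 F m l n + \<Delta>x *\<^sub>R (\<Sum>k'=1..s. bx k' *\<^sub>R (D1 *v delx F m k' l n)) \<and>
        D2 *v stage F m k l n = D2 *v y0 F m k n + \<Delta>y *\<^sub>R (\<Sum>j=1..s. ay l j *\<^sub>R (D2 *v dely F m k j n)) \<and>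
        D2 *v y1 F m k n = D2 *v y0 F m k n + \<Delta>y *\<^sub>R (\<Sum>l'=1..s. by l' *\<^sub>R (D2 *v dely F m k l' n)) \<and>
        D3 *v stage F m k l n = D3 *v z0 F m k l + \<Delta>z *\<^sub>R (\<Sum>j=1..s. az n j *\<^sub>R (D3 *v delz F m k l j)) \<and>
        D3 *v z1 F m k l = D3 *v z0 F m k l + \<Delta>z *\<^sub>R (\<Sum>n'=1..s. bz n' *\<^sub>R (D3 *v delz F m k l n')))"

definition discrete_curl :: "cell_field \<Rightarrow> nat \<Rightarrow> nat \<Rightarrow> nat \<Rightarrow> nat \<Rightarrow> real ^ 3" where
  "discrete_curl F m k l n = D1 *v delx F m k l n + D2 *v dely F m k l n + D3 *v delz F m k l n"

text \<open>
  The arguments \<open>ta\<close>, \<open>tb\<close>, \<open>ba\<close>, \<open>bb\<close> are the coefficient families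
  $\tilde a^{(\ell)}$, $\tilde b^{(\ell)}$, $\bar a^{(\ell)}$, $\bar b^{(\ell)}$, with \<open>\<ell>\<close> as first
  argument; \<open>dW k l n\<close> is the noise increment.
\<close>

definition temporal_relations ::
  "nat \<Rightarrow> nat \<Rightarrow> real \<Rightarrow> real \<Rightarrow> (nat \<Rightarrow> nat \<Rightarrow> nat \<Rightarrow> real) \<Rightarrow>
   (nat \<Rightarrow> nat \<Rightarrow> nat \<Rightarrow> real) \<Rightarrow> (nat \<Rightarrow> nat \<Rightarrow> real) \<Rightarrow>
   (nat \<Rightarrow> nat \<Rightarrow> nat \<Rightarrow> real) \<Rightarrow> (nat \<Rightarrow> nat \<Rightarrow> real) \<Rightarrow> cell_field \<Rightarrow> cell_field \<Rightarrow> bool" where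
  "temporal_relations s r lam \<Delta>t dW ta tb ba bb H E \<longleftrightarrow>
     (\<forall>k\<in>{1..s}. \<forall>l\<in>{1..s}. \<forall>n\<in>{1..s}.
        (\<forall>m\<in>{1..r}.
           stage H m k l n = t0 H k l n - \<Delta>t *\<^sub>R (\<Sum>i=1..r. ta 1 m i *\<^sub>R discrete_curl E i k l n)
             + (lam * dW k l n) *\<^sub>R (\<Sum>i=1..r. ba 1 m i *\<^sub>R stage E i k l n) \<and>
           stage E m k l n = t0 E k l n + \<Delta>t *\<^sub>R (\<Sum>i=1..r. ta 2 m i *\<^sub>R discrete_curl H i k l n)
             - (lam * dW k l n) *\<^sub>R (\<Sum>i=1..r. ba 2 m i *\<^sub>R stage H i k l n)) \<and>
        t1 H k l n = t0 H k l n - \<Delta>t *\<^sub>R (\<Sum>m=1..r. tb 1 m *\<^sub>R discrete_curl E m k l n)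
          + (lam * dW k l n) *\<^sub>R (\<Sum>m=1..r. bb 1 m *\<^sub>R stage E m k l n) \<and>
        t1 E k l n = t0 E k l n + \<Delta>t *\<^sub>R (\<Sum>m=1..r. tb 2 m *\<^sub>R discrete_curl H m k l n)
          - (lam * dW k l n) *\<^sub>R (\<Sum>m=1..r. bb 2 m *\<^sub>R stage H m k l n))"

definition maxwell_PRK ::
  "nat \<Rightarrow> nat \<Rightarrow> real \<Rightarrow> real \<Rightarrow> real \<Rightarrow> real \<Rightarrow> real \<Rightarrow> (nat \<Rightarrow> nat \<Rightarrow> nat \<Rightarrow> real) \<Rightarrow>
   (nat \<Rightarrow> nat \<Rightarrow> nat \<Rightarrow> real) \<Rightarrow> (nat \<Rightarrow> nat \<Rightarrow> real) \<Rightarrow>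
   (nat \<Rightarrow> nat \<Rightarrow> nat \<Rightarrow> real) \<Rightarrow> (nat \<Rightarrow> nat \<Rightarrow> real) \<Rightarrow>
   (nat \<Rightarrow> nat \<Rightarrow> nat \<Rightarrow> real) \<Rightarrow> (nat \<Rightarrow> nat \<Rightarrow> real) \<Rightarrow> cell_field \<Rightarrow> cell_field \<Rightarrow> bool" where
  "maxwell_PRK s r lam \<Delta>x \<Delta>y \<Delta>z \<Delta>t dW a b ta tb ba bb H E \<longleftrightarrow>
     spatial_relations s r \<Delta>x \<Delta>y \<Delta>z (a 1) (b 1) (a 2) (b 2) (a 3) (b 3) H \<and>
     spatial_relations s r \<Delta>x \<Delta>y \<Delta>z (a 4) (b 4) (a 5) (b 5) (a 6) (b 6) E \<and>
     temporal_relations s r lam \<Delta>t dW ta tb ba bb H E"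

end

(*
  The differentials along a fixed tangent vector solve the same scheme, so the law is an identity
  between two solutions of the linearized scheme. A partitioned Runge--Kutta method whose
  coefficients satisfy the symplectic conditions changes every bilinear form by the weighted sum of
  its stage derivatives. In time, with the form E . H', the noise contributes only dE /\ dE and
  dH /\ dH, which vanish, and the increment is -dt times the weighted stage values of
  dE /\ C(dE) + dH /\ C(dH). In space only D_i X is known, but X . D_i Y is a form in D_i X and
  D_i Y because D_i ^ 3 = - D_i, and the flux differences are exactly the three parts of that sum.
*)

theory Submission
  imports Defs
begin

section \<open>Bilinear forms along partitioned Runge--Kutta steps\<close>

text \<open>Expanding \<open>B p1 q1\<close> gives first-order terms at \<open>p0\<close> and
  \<open>q0\<close> plus a double sum with weights \<open>\<beta> i * \<gamma> j\<close>. Passing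
  from \<open>p0\<close>, \<open>q0\<close> to the stages \<open>P j\<close>, \<open>Q i\<close>
  adds double sums with weights \<open>\<alpha> j i * \<gamma> j\<close> and
  \<open>\<beta> i * \<alpha>' i j\<close>, and the symplectic condition says that these two add up
  to the first. General finite index sets let drift and noise terms later count as separate indices
  of one method.\<close>

lemma bilinear_PRK_conservation:
  fixes B :: "'v::real_vector \<Rightarrow> 'u::real_vector \<Rightarrow> real"
  assumes B: "bilinear B" and fin: "finite I" "finite J"
    and p1: "p1 = p0 + (\<Sum>i\<in>I. \<beta> i *\<^sub>R F i)"
    and q1: "q1 = q0 + (\<Sum>j\<in>J. \<gamma> j *\<^sub>R G j)"
    and P: "\<And>j. j \<in> J \<Longrightarrow> P j = p0 + (\<Sum>i\<in>I. \<alpha> j i *\<^sub>R F i)"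
    and Q: "\<And>i. i \<in> I \<Longrightarrow> Q i = q0 + (\<Sum>j\<in>J. \<alpha>' i j *\<^sub>R G j)"
    and sympl: "\<And>i j. \<lbrakk>i \<in> I; j \<in> J\<rbrakk> \<Longrightarrow> \<alpha> j i * \<gamma> j + \<beta> i * \<alpha>' i j - \<beta> i * \<gamma> j = 0"
  shows "B p1 q1 - B p0 q0 = (\<Sum>j\<in>J. \<gamma> j * B (P j) (G j)) + (\<Sum>i\<in>I. \<beta> i * B (F i) (Q i))"
proof -
  note add = bilinear_ladd[OF B] bilinear_radd[OF B]
  note mul = bilinear_lmul[OF B] bilinear_rmul[OF B]
  have lin: "linear (\<lambda>x. B x y)" "linear (B x)" for x y
    using B by (simp_all add: bilinear_def)
  have sl: "B (\<Sum>i\<in>I. c i *\<^sub>R F i) y = (\<Sum>i\<in>I. c i * B (F i) y)" for c y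
    by (simp add: linear_sum[OF lin(1)] mul)
  have sr: "B x (\<Sum>j\<in>J. c j *\<^sub>R G j) = (\<Sum>j\<in>J. c j * B x (G j))" for c x
    by (simp add: linear_sum[OF lin(2)] mul)
  have "B p1 q1 - B p0 q0 =
      (\<Sum>j\<in>J. \<gamma> j * B p0 (G j)) + (\<Sum>i\<in>I. \<beta> i * B (F i) q0)
      + (\<Sum>i\<in>I. \<Sum>j\<in>J. \<beta> i * \<gamma> j * B (F i) (G j))"
    by (simp add: p1 q1 add sl sr sum_distrib_left sum.distrib algebra_simps) (rule sum.swap)
  moreover have "(\<Sum>j\<in>J. \<gamma> j * B (P j) (G j)) =
      (\<Sum>j\<in>J. \<gamma> j * B p0 (G j)) + (\<Sum>i\<in>I. \<Sum>j\<in>J. \<alpha> j i * \<gamma> j * B (F i) (G j))"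
    by (subst sum.swap[of _ _ I])
      (simp add: P add sl sum_distrib_left sum.distrib algebra_simps)
  moreover have "(\<Sum>i\<in>I. \<beta> i * B (F i) (Q i)) =
      (\<Sum>i\<in>I. \<beta> i * B (F i) q0) + (\<Sum>i\<in>I. \<Sum>j\<in>J. \<beta> i * \<alpha>' i j * B (F i) (G j))"
    by (simp add: Q add sr sum_distrib_left sum.distrib algebra_simps)
  moreover have "(\<Sum>i\<in>I. \<Sum>j\<in>J. \<beta> i * \<gamma> j * B (F i) (G j)) =
      (\<Sum>i\<in>I. \<Sum>j\<in>J. \<alpha> j i * \<gamma> j * B (F i) (G j)) + (\<Sum>i\<in>I. \<Sum>j\<in>J. \<beta> i * \<alpha>' i j * B (F i) (G j))"
    unfolding sum.distrib[symmetric]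
  proof (intro sum.cong refl)
    fix i j assume "i \<in> I" "j \<in> J"
    then have "\<beta> i * \<gamma> j = \<alpha> j i * \<gamma> j + \<beta> i * \<alpha>' i j"
      using sympl by fastforce
    then show "\<beta> i * \<gamma> j * B (F i) (G j) = \<alpha> j i * \<gamma> j * B (F i) (G j) + \<beta> i * \<alpha>' i j * B (F i) (G j)"
      by (simp add: distrib_right)
  qed
  ultimately show ?thesis by simp
qed

section \<open>Linearization of the scheme along a tangent vector\<close>

text \<open>The directional derivatives are packed into a \<open>cell_field\<close> again, so that
  the predicates of the scheme apply to them unchanged.\<close>

definition linearized :: "('p::real_normed_vector \<Rightarrow> cell_field) \<Rightarrow> 'p \<Rightarrow> 'p \<Rightarrow> cell_field" where
  "linearized F \<theta> v =
    \<lparr>stage = \<lambda>m k l n. frechet_derivative (\<lambda>\<theta>'. stage (F \<theta>') m k l n) (at \<theta>) v,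
     delx = \<lambda>m k l n. frechet_derivative (\<lambda>\<theta>'. delx (F \<theta>') m k l n) (at \<theta>) v,
     dely = \<lambda>m k l n. frechet_derivative (\<lambda>\<theta>'. dely (F \<theta>') m k l n) (at \<theta>) v,
     delz = \<lambda>m k l n. frechet_derivative (\<lambda>\<theta>'. delz (F \<theta>') m k l n) (at \<theta>) v,
     x0 = \<lambda>m l n. frechet_derivative (\<lambda>\<theta>'. x0 (F \<theta>') m l n) (at \<theta>) v,
     x1 = \<lambda>m l n. frechet_derivative (\<lambda>\<theta>'. x1 (F \<theta>') m l n) (at \<theta>) v,
     y0 = \<lambda>m k n. frechet_derivative (\<lambda>\<theta>'. y0 (F \<theta>') m k n) (at \<theta>) v,
     y1 = \<lambda>m k n. frechet_derivative (\<lambda>\<theta>'. y1 (F \<theta>') m k n) (at \<theta>) v,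
     z0 = \<lambda>m k l. frechet_derivative (\<lambda>\<theta>'. z0 (F \<theta>') m k l) (at \<theta>) v,
     z1 = \<lambda>m k l. frechet_derivative (\<lambda>\<theta>'. z1 (F \<theta>') m k l) (at \<theta>) v,
     t0 = \<lambda>k l n. frechet_derivative (\<lambda>\<theta>'. t0 (F \<theta>') k l n) (at \<theta>) v,
     t1 = \<lambda>k l n. frechet_derivative (\<lambda>\<theta>'. t1 (F \<theta>') k l n) (at \<theta>) v\<rparr>"

text \<open>The derivative is written as a function of the tangent vector through
  \<open>linearized\<close>, the form in which the relations of the linearized scheme are derived.
  The order of the twelve conclusions is that of the record fields; the theorem selects them by
  position, with those for \<open>E\<close> shifted by twelve.\<close>

lemma differentiable_field_has_derivative:
  assumes "differentiable_field s r F \<theta>"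
  shows "\<And>m k l n. \<lbrakk>m \<in> {1..r}; k \<in> {1..s}; l \<in> {1..s}; n \<in> {1..s}\<rbrakk> \<Longrightarrow>
      ((\<lambda>\<theta>'. stage (F \<theta>') m k l n) has_derivative (\<lambda>v. stage (linearized F \<theta> v) m k l n)) (at \<theta>)"
    and "\<And>m k l n. \<lbrakk>m \<in> {1..r}; k \<in> {1..s}; l \<in> {1..s}; n \<in> {1..s}\<rbrakk> \<Longrightarrow>
      ((\<lambda>\<theta>'. delx (F \<theta>') m k l n) has_derivative (\<lambda>v. delx (linearized F \<theta> v) m k l n)) (at \<theta>)"
    and "\<And>m k l n. \<lbrakk>m \<in> {1..r}; k \<in> {1..s}; l \<in> {1..s}; n \<in> {1..s}\<rbrakk> \<Longrightarrow>
      ((\<lambda>\<theta>'. dely (F \<theta>') m k l n) has_derivative (\<lambda>v. dely (linearized F \<theta> v) m k l n)) (at \<theta>)"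
    and "\<And>m k l n. \<lbrakk>m \<in> {1..r}; k \<in> {1..s}; l \<in> {1..s}; n \<in> {1..s}\<rbrakk> \<Longrightarrow>
      ((\<lambda>\<theta>'. delz (F \<theta>') m k l n) has_derivative (\<lambda>v. delz (linearized F \<theta> v) m k l n)) (at \<theta>)"
    and "\<And>m i j. \<lbrakk>m \<in> {1..r}; i \<in> {1..s}; j \<in> {1..s}\<rbrakk> \<Longrightarrow>
      ((\<lambda>\<theta>'. x0 (F \<theta>') m i j) has_derivative (\<lambda>v. x0 (linearized F \<theta> v) m i j)) (at \<theta>)"
    and "\<And>m i j. \<lbrakk>m \<in> {1..r}; i \<in> {1..s}; j \<in> {1..s}\<rbrakk> \<Longrightarrow>
      ((\<lambda>\<theta>'. x1 (F \<theta>') m i j) has_derivative (\<lambda>v. x1 (linearized F \<theta> v) m i j)) (at \<theta>)"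
    and "\<And>m i j. \<lbrakk>m \<in> {1..r}; i \<in> {1..s}; j \<in> {1..s}\<rbrakk> \<Longrightarrow>
      ((\<lambda>\<theta>'. y0 (F \<theta>') m i j) has_derivative (\<lambda>v. y0 (linearized F \<theta> v) m i j)) (at \<theta>)"
    and "\<And>m i j. \<lbrakk>m \<in> {1..r}; i \<in> {1..s}; j \<in> {1..s}\<rbrakk> \<Longrightarrow>
      ((\<lambda>\<theta>'. y1 (F \<theta>') m i j) has_derivative (\<lambda>v. y1 (linearized F \<theta> v) m i j)) (at \<theta>)"
    and "\<And>m i j. \<lbrakk>m \<in> {1..r}; i \<in> {1..s}; j \<in> {1..s}\<rbrakk> \<Longrightarrow>
      ((\<lambda>\<theta>'. z0 (F \<theta>') m i j) has_derivative (\<lambda>v. z0 (linearized F \<theta> v) m i j)) (at \<theta>)"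
    and "\<And>m i j. \<lbrakk>m \<in> {1..r}; i \<in> {1..s}; j \<in> {1..s}\<rbrakk> \<Longrightarrow>
      ((\<lambda>\<theta>'. z1 (F \<theta>') m i j) has_derivative (\<lambda>v. z1 (linearized F \<theta> v) m i j)) (at \<theta>)"
    and "\<And>k l n. \<lbrakk>k \<in> {1..s}; l \<in> {1..s}; n \<in> {1..s}\<rbrakk> \<Longrightarrow>
      ((\<lambda>\<theta>'. t0 (F \<theta>') k l n) has_derivative (\<lambda>v. t0 (linearized F \<theta> v) k l n)) (at \<theta>)"
    and "\<And>k l n. \<lbrakk>k \<in> {1..s}; l \<in> {1..s}; n \<in> {1..s}\<rbrakk> \<Longrightarrow>
      ((\<lambda>\<theta>'. t1 (F \<theta>') k l n) has_derivative (\<lambda>v. t1 (linearized F \<theta> v) k l n)) (at \<theta>)"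
  using assms
  by (simp_all add: differentiable_field_def linearized_def frechet_derivative_works[symmetric])

lemmas has_derivative_matrix_vector [derivative_intros] =
  bounded_linear.has_derivative[OF matrix_vector_mul_bounded_linear]

text \<open>Differentiating an equation needs it on a neighbourhood: there \<open>g\<close> inherits
  the derivative of \<open>f\<close>, and derivatives are unique.\<close>

lemma has_derivative_eq_on_open:
  assumes "(f has_derivative f') (at \<theta>)" "(g has_derivative g') (at \<theta>)"
    and "open \<Theta>" "\<theta> \<in> \<Theta>" "\<And>\<theta>'. \<theta>' \<in> \<Theta> \<Longrightarrow> f \<theta>' = g \<theta>'"
  shows "f' v = g' v"
proof -
  have "(g has_derivative f') (at \<theta>)"
    using has_derivative_transform_within_open[OF assms(1,3,4)] assms(5) by blast
  then show ?thesis using has_derivative_unique assms(2) by blast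
qed

lemma linearized_spatial_relations:
  assumes \<Theta>: "open \<Theta>" "\<theta> \<in> \<Theta>"
    and "differentiable_field s r F \<theta>"
    and rel: "\<And>\<theta>'. \<theta>' \<in> \<Theta> \<Longrightarrow> spatial_relations s r \<Delta>x \<Delta>y \<Delta>z ax bx ay by az bz (F \<theta>')"
  shows "spatial_relations s r \<Delta>x \<Delta>y \<Delta>z ax bx ay by az bz (linearized F \<theta> v)"
  unfolding spatial_relations_def
proof (intro ballI conjI)
  note d = differentiable_field_has_derivative[OF assms(3)]
  note rel' = rel[unfolded spatial_relations_def, rule_format]
  fix m k l n assume i: "m \<in> {1..r}" "k \<in> {1..s}" "l \<in> {1..s}" "n \<in> {1..s}"
  let ?L = "linearized F \<theta> v"
  \<comment> \<open>The rule leaves the two functions of the parameter schematic. The derivative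
    rules determine them from the two sides of the goal, and the relation at an arbitrary point of
    \<open>\<Theta>\<close> then equates them. The other equations follow the same pattern.\<close>
  show "D1 *v stage ?L m k l n = D1 *v x0 ?L m l n + \<Delta>x *\<^sub>R (\<Sum>j=1..s. ax k j *\<^sub>R (D1 *v delx ?L m j l n))"
    by (rule has_derivative_eq_on_open[OF _ _ \<Theta>, where v = v])
      (rule derivative_intros d i | use rel'[OF _ i] in blast | assumption)+
  show "D1 *v x1 ?L m l n = D1 *v x0 ?L m l n + \<Delta>x *\<^sub>R (\<Sum>k'=1..s. bx k' *\<^sub>R (D1 *v delx ?L m k' l n))"
    by (rule has_derivative_eq_on_open[OF _ _ \<Theta>, where v = v])
      (rule derivative_intros d i | use rel'[OF _ i] in blast | assumption)+
  show "D2 *v stage ?L m k l n = D2 *v y0 ?L m k n + \<Delta>y *\<^sub>R (\<Sum>j=1..s. ay l j *\<^sub>R (D2 *v dely ?L m k j n))"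
    by (rule has_derivative_eq_on_open[OF _ _ \<Theta>, where v = v])
      (rule derivative_intros d i | use rel'[OF _ i] in blast | assumption)+
  show "D2 *v y1 ?L m k n = D2 *v y0 ?L m k n + \<Delta>y *\<^sub>R (\<Sum>l'=1..s. by l' *\<^sub>R (D2 *v dely ?L m k l' n))"
    by (rule has_derivative_eq_on_open[OF _ _ \<Theta>, where v = v])
      (rule derivative_intros d i | use rel'[OF _ i] in blast | assumption)+
  show "D3 *v stage ?L m k l n = D3 *v z0 ?L m k l + \<Delta>z *\<^sub>R (\<Sum>j=1..s. az n j *\<^sub>R (D3 *v delz ?L m k l j))"
    by (rule has_derivative_eq_on_open[OF _ _ \<Theta>, where v = v])
      (rule derivative_intros d i | use rel'[OF _ i] in blast | assumption)+
  show "D3 *v z1 ?L m k l = D3 *v z0 ?L m k l + \<Delta>z *\<^sub>R (\<Sum>n'=1..s. bz n' *\<^sub>R (D3 *v delz ?L m k l n'))"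
    by (rule has_derivative_eq_on_open[OF _ _ \<Theta>, where v = v])
      (rule derivative_intros d i | use rel'[OF _ i] in blast | assumption)+
qed

lemma has_derivative_discrete_curl:
  assumes "differentiable_field s r F \<theta>"
    and "m \<in> {1..r}" "k \<in> {1..s}" "l \<in> {1..s}" "n \<in> {1..s}"
  shows "((\<lambda>\<theta>'. discrete_curl (F \<theta>') m k l n) has_derivative
    (\<lambda>v. discrete_curl (linearized F \<theta> v) m k l n)) (at \<theta>)"
  unfolding discrete_curl_def
  by (intro derivative_intros differentiable_field_has_derivative[OF assms(1)] assms(2-))

text \<open>For a fixed realization \<open>dW\<close> does not depend on the parameter, so the noise
  terms, like the drift terms, are linear in the fields with constant coefficients.\<close>

lemma linearized_temporal_relations:
  assumes \<Theta>: "open \<Theta>" "\<theta> \<in> \<Theta>"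
    and dH: "differentiable_field s r H \<theta>" and dE: "differentiable_field s r E \<theta>"
    and rel: "\<And>\<theta>'. \<theta>' \<in> \<Theta> \<Longrightarrow> temporal_relations s r lam \<Delta>t dW ta tb ba bb (H \<theta>') (E \<theta>')"
  shows "temporal_relations s r lam \<Delta>t dW ta tb ba bb (linearized H \<theta> v) (linearized E \<theta> v)"
  unfolding temporal_relations_def
proof (intro ballI conjI)
  note d = differentiable_field_has_derivative[OF dH] differentiable_field_has_derivative[OF dE]
    has_derivative_discrete_curl[OF dH] has_derivative_discrete_curl[OF dE]
  note rel' = rel[unfolded temporal_relations_def, rule_format]
  fix k l n assume i: "k \<in> {1..s}" "l \<in> {1..s}" "n \<in> {1..s}"
  let ?H = "linearized H \<theta> v" and ?E = "linearized E \<theta> v"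
  {
    fix m assume m: "m \<in> {1..r}"
    show "stage ?H m k l n = t0 ?H k l n - \<Delta>t *\<^sub>R (\<Sum>i=1..r. ta 1 m i *\<^sub>R discrete_curl ?E i k l n)
        + (lam * dW k l n) *\<^sub>R (\<Sum>i=1..r. ba 1 m i *\<^sub>R stage ?E i k l n)"
      by (rule has_derivative_eq_on_open[OF _ _ \<Theta>, where v = v])
        (rule derivative_intros d i m | use rel'[OF _ i] m in blast | assumption)+
    show "stage ?E m k l n = t0 ?E k l n + \<Delta>t *\<^sub>R (\<Sum>i=1..r. ta 2 m i *\<^sub>R discrete_curl ?H i k l n)
        - (lam * dW k l n) *\<^sub>R (\<Sum>i=1..r. ba 2 m i *\<^sub>R stage ?H i k l n)"
      by (rule has_derivative_eq_on_open[OF _ _ \<Theta>, where v = v])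
        (rule derivative_intros d i m | use rel'[OF _ i] m in blast | assumption)+
  }
  show "t1 ?H k l n = t0 ?H k l n - \<Delta>t *\<^sub>R (\<Sum>m=1..r. tb 1 m *\<^sub>R discrete_curl ?E m k l n)
      + (lam * dW k l n) *\<^sub>R (\<Sum>m=1..r. bb 1 m *\<^sub>R stage ?E m k l n)"
    by (rule has_derivative_eq_on_open[OF _ _ \<Theta>, where v = v])
      (rule derivative_intros d i | use rel'[OF _ i] in blast | assumption)+
  show "t1 ?E k l n = t0 ?E k l n + \<Delta>t *\<^sub>R (\<Sum>m=1..r. tb 2 m *\<^sub>R discrete_curl ?H m k l n)
      - (lam * dW k l n) *\<^sub>R (\<Sum>m=1..r. bb 2 m *\<^sub>R stage ?H m k l n)"
    by (rule has_derivative_eq_on_open[OF _ _ \<Theta>, where v = v])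
      (rule derivative_intros d i | use rel'[OF _ i] in blast | assumption)+
qed

section \<open>Wedge products evaluated on two tangent vectors\<close>

lemma ext_d_component:
  fixes X :: "'p::real_normed_vector \<Rightarrow> real ^ 'n"
  assumes "(X has_derivative X') (at \<theta>)"
  shows "ext_d (\<lambda>\<theta>'. X \<theta>' $ i) \<theta> v = X' v $ i"
  unfolding ext_d_def
  using frechet_derivative_at[OF bounded_linear.has_derivative[OF bounded_linear_vec_nth assms]]
  by metis

lemma wedge_vec_eq_inner:
  assumes "(X has_derivative X') (at \<theta>)" "(Y has_derivative Y') (at \<theta>)"
  shows "wedge_vec X Y \<theta> \<xi> \<eta> = X' \<xi> \<bullet> Y' \<eta> - X' \<eta> \<bullet> Y' \<xi>"
  by (simp add: wedge_vec_def wedge_def ext_d_component[OF assms(1)] ext_d_component[OF assms(2)]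
      inner_vec_def sum_subtractf)

text \<open>The index type \<open>3 + 3\<close> splits the double sum into four blocks. The mixed
  blocks carry zero entries, so the two fields contribute separately.\<close>

lemma wedge_mat_stack_eq_inner:
  assumes X: "(X has_derivative X') (at \<theta>)" and Y: "(Y has_derivative Y') (at \<theta>)"
  shows "wedge_mat (block_diag A) (\<lambda>\<theta>'. stack (X \<theta>') (Y \<theta>')) \<theta> \<xi> \<eta> =
    X' \<xi> \<bullet> (A *v X' \<eta>) - X' \<eta> \<bullet> (A *v X' \<xi>) + (Y' \<xi> \<bullet> (A *v Y' \<eta>) - Y' \<eta> \<bullet> (A *v Y' \<xi>))"
proof -
  have sum_sum: "(\<Sum>p\<in>UNIV. f p) = (\<Sum>i\<in>UNIV. f (Inl i)) + (\<Sum>i\<in>UNIV. f (Inr i))"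
    for f :: "3 + 3 \<Rightarrow> real"
    by (subst UNIV_Plus_UNIV[symmetric], subst sum.Plus) simp_all
  show ?thesis
    by (simp add: wedge_mat_def sum_sum block_diag_def stack_def wedge_def
        ext_d_component[OF X] ext_d_component[OF Y]
        inner_vec_def matrix_vector_mult_def sum_distrib_left right_diff_distrib
        sum_subtractf sum.distrib mult_ac)
qed

section \<open>The matrices of the curl and the spatial Runge--Kutta relations\<close>

text \<open>These two properties hold for the matrix of the cross product with a unit vector;
  \<open>D1\<close>, \<open>D2\<close>, \<open>D3\<close> belong to the three coordinate
  vectors.\<close>

definition curl_component :: "real ^ 3 ^ 3 \<Rightarrow> bool" where
  "curl_component A \<longleftrightarrow> transpose A = - A \<and> A ** A ** A = - A"

lemma curl_component_D1: "curl_component D1"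
  and curl_component_D2: "curl_component D2"
  and curl_component_D3: "curl_component D3"
  by (simp_all add: curl_component_def vec_eq_iff forall_3 transpose_def matrix_matrix_mult_def
      sum_3 D1_def D2_def D3_def)

text \<open>The second identity follows from skewness and the cube rule. It expresses the pairing of
  \<open>x\<close> with \<open>A *v y\<close> through the images \<open>A *v x\<close> and
  \<open>A *v y\<close> alone, which are what the spatial relations control.\<close>

lemma curl_component_inner:
  assumes "curl_component A"
  shows "x \<bullet> (A *v y) = - ((A *v x) \<bullet> y)"
    and "(A *v x) \<bullet> (A *v (A *v y)) = x \<bullet> (A *v y)"
proof -
  have minus: "(- A) *v x = - (A *v x)" for x
    by (simp add: vec_eq_iff matrix_vector_mult_def sum_negf)
  have adj: "x \<bullet> (A *v y) = - ((A *v x) \<bullet> y)" for x y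
  proof -
    have "x \<bullet> (A *v y) = (transpose A *v x) \<bullet> y"
      by (metis dot_lmul_matrix transpose_matrix_vector)
    also have "transpose A = - A"
      using assms by (simp add: curl_component_def)
    finally show ?thesis by (simp add: minus)
  qed
  then show "x \<bullet> (A *v y) = - ((A *v x) \<bullet> y)" .
  have "A *v (A *v (A *v y)) = - (A *v y)"
    using assms by (simp add: curl_component_def matrix_vector_mul_assoc matrix_mul_assoc minus)
  then show "(A *v x) \<bullet> (A *v (A *v y)) = x \<bullet> (A *v y)"
    using adj[of x "A *v (A *v y)"] by simp
qed

definition symplectic_coeffs :: "nat \<Rightarrow> (nat \<Rightarrow> nat \<Rightarrow> real) \<Rightarrow> (nat \<Rightarrow> real) \<Rightarrow> bool" where
  "symplectic_coeffs s a b \<longleftrightarrow>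
    (\<forall>j\<in>{1..s}. \<forall>k\<in>{1..s}. a k j * b k + b j * a j k - b j * b k = 0)"

text \<open>The bilinear identity is applied to the images under \<open>A\<close>, with slopes
  \<open>h *\<^sub>R (A *v \<delta> k)\<close> and \<open>h *\<^sub>R (A *v \<epsilon> k)\<close>.
  Both quantities use the same coefficients, so \<open>symplectic_coeffs\<close> is exactly the
  required condition; \<open>curl_component_inner\<close> then removes the additional factor
  \<open>A\<close> from the pairings.\<close>

lemma spatial_RK_conservation:
  assumes A: "curl_component A"
    and X: "\<And>k. k \<in> {1..s} \<Longrightarrow> A *v X k = A *v X0 + h *\<^sub>R (\<Sum>j=1..s. a k j *\<^sub>R (A *v \<delta> j))"
      "A *v X1 = A *v X0 + h *\<^sub>R (\<Sum>k=1..s. b k *\<^sub>R (A *v \<delta> k))"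
    and Y: "\<And>k. k \<in> {1..s} \<Longrightarrow> A *v Y k = A *v Y0 + h *\<^sub>R (\<Sum>j=1..s. a k j *\<^sub>R (A *v \<epsilon> j))"
      "A *v Y1 = A *v Y0 + h *\<^sub>R (\<Sum>k=1..s. b k *\<^sub>R (A *v \<epsilon> k))"
    and sympl: "symplectic_coeffs s a b"
  shows "X1 \<bullet> (A *v Y1) - X0 \<bullet> (A *v Y0) =
    h * (\<Sum>k=1..s. b k * (X k \<bullet> (A *v \<epsilon> k) - Y k \<bullet> (A *v \<delta> k)))"
proof -
  note inner = curl_component_inner[OF A]
  let ?B = "\<lambda>u v. u \<bullet> (A *v v)"
  have B: "bilinear ?B"
    unfolding bilinear_def
    by (auto intro!: linearI simp: inner_add_left inner_add_right matrix_vector_right_distrib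
        matrix_vector_mult_scaleR)
  have "?B (A *v X1) (A *v Y1) - ?B (A *v X0) (A *v Y0) =
      (\<Sum>j=1..s. b j * ?B (A *v X j) (h *\<^sub>R (A *v \<epsilon> j)))
      + (\<Sum>i=1..s. b i * ?B (h *\<^sub>R (A *v \<delta> i)) (A *v Y i))"
    by (rule bilinear_PRK_conservation[OF B finite_atLeastAtMost finite_atLeastAtMost,
          where \<alpha> = a and \<alpha>' = a], rule_tac [5] sympl[unfolded symplectic_coeffs_def, rule_format])
      (simp_all add: X Y scaleR_sum_right mult.commute)
  \<comment> \<open>Skewness moves \<open>A\<close> from the stage value to the slope, which
    produces the minus sign in the claim.\<close>
  moreover have "?B (A *v \<delta> k) (A *v Y k) = - (Y k \<bullet> (A *v \<delta> k))" for k
    using inner(1)[of "\<delta> k" "Y k"] by (simp add: inner(2) inner_commute)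
  ultimately show ?thesis
    by (simp add: inner(2) sum_distrib_left sum.distrib[symmetric] algebra_simps matrix_vector_mult_scaleR)
qed

section \<open>The temporal relations with noise\<close>

text \<open>For the linearizations \<open>F\<close> and \<open>G\<close> of one field along two
  tangent vectors, this is the value on them of the wedge product of dX with its discrete
  curl.\<close>

definition curl_pairing :: "cell_field \<Rightarrow> cell_field \<Rightarrow> nat \<Rightarrow> nat \<Rightarrow> nat \<Rightarrow> nat \<Rightarrow> real" where
  "curl_pairing F G m k l n = stage F m k l n \<bullet> discrete_curl G m k l n - stage G m k l n \<bullet> discrete_curl F m k l n"

text \<open>The bilinear identity for \<open>E\<close> against \<open>H'\<close> is antisymmetrized
  in the two solutions. Its noise part consists of the products of \<open>E\<close> with
  \<open>E'\<close> and of \<open>H\<close> with \<open>H'\<close>, each symmetric under the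
  exchange, so each cancels; the drift part becomes the two curl pairings.\<close>

lemma temporal_PRK_conservation:
  assumes rel: "temporal_relations s r lam \<Delta>t dW ta tb ba bb H E"
      "temporal_relations s r lam \<Delta>t dW ta tb ba bb H' E'"
    and sympl: "\<And>i m. \<lbrakk>i \<in> {1..r}; m \<in> {1..r}\<rbrakk> \<Longrightarrow> ta 2 m i * tb 1 m + tb 2 i * ta 1 i m - tb 2 i * tb 1 m = 0"
      "\<And>i m. \<lbrakk>i \<in> {1..r}; m \<in> {1..r}\<rbrakk> \<Longrightarrow> ba 2 m i * tb 1 m + bb 2 i * ta 1 i m - bb 2 i * tb 1 m = 0"
      "\<And>i m. \<lbrakk>i \<in> {1..r}; m \<in> {1..r}\<rbrakk> \<Longrightarrow> ta 2 m i * bb 1 m + tb 2 i * ba 1 i m - tb 2 i * bb 1 m = 0"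
      "\<And>i m. \<lbrakk>i \<in> {1..r}; m \<in> {1..r}\<rbrakk> \<Longrightarrow> ba 2 m i * bb 1 m + bb 2 i * ba 1 i m - bb 2 i * bb 1 m = 0"
    and tb: "\<And>m. m \<in> {1..r} \<Longrightarrow> tb 1 m = tb 2 m"
    and i: "k \<in> {1..s}" "l \<in> {1..s}" "n \<in> {1..s}"
  shows "(t1 E k l n \<bullet> t1 H' k l n - t1 E' k l n \<bullet> t1 H k l n)
      - (t0 E k l n \<bullet> t0 H' k l n - t0 E' k l n \<bullet> t0 H k l n) =
    - \<Delta>t * (\<Sum>m=1..r. tb 1 m * (curl_pairing H H' m k l n + curl_pairing E E' m k l n))"
proof -
  let ?w = "lam * dW k l n"
  have B: "bilinear ((\<bullet>) :: real ^ 3 \<Rightarrow> real ^ 3 \<Rightarrow> real)"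
    by (rule bilinear_conv_bounded_bilinear[THEN iffD2, OF bounded_bilinear_inner])
  have main: "t1 E k l n \<bullet> t1 H' k l n - t0 E k l n \<bullet> t0 H' k l n =
      (\<Sum>m=1..r. tb 1 m * (\<Delta>t * (discrete_curl H m k l n \<bullet> stage H' m k l n - stage E m k l n \<bullet> discrete_curl E' m k l n))
        + ?w * (bb 1 m * (stage E m k l n \<bullet> stage E' m k l n) - bb 2 m * (stage H m k l n \<bullet> stage H' m k l n)))"
    if H: "temporal_relations s r lam \<Delta>t dW ta tb ba bb H E"
      and H': "temporal_relations s r lam \<Delta>t dW ta tb ba bb H' E'" for H E H' E'
  proof -
    \<comment> \<open>The left summand indexes the drift terms, the right one the noise terms.\<close>
    let ?I = "{1..r} <+> {1..r}" and ?pr = "case_sum (\<lambda>m. m) (\<lambda>m. m)"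
    let ?F = "case_sum (\<lambda>i. \<Delta>t *\<^sub>R discrete_curl H i k l n) (\<lambda>i. - (?w *\<^sub>R stage H i k l n))"
    let ?G = "case_sum (\<lambda>i. - (\<Delta>t *\<^sub>R discrete_curl E' i k l n)) (\<lambda>i. ?w *\<^sub>R stage E' i k l n)"
    let ?b = "\<lambda>L. case_sum (tb L) (bb L)"
    let ?a = "\<lambda>L j. case_sum (ta L (?pr j)) (ba L (?pr j))"
    note E_eq = H[unfolded temporal_relations_def, rule_format, OF i]
    note H_eq = H'[unfolded temporal_relations_def, rule_format, OF i]
    have "t1 E k l n \<bullet> t1 H' k l n - t0 E k l n \<bullet> t0 H' k l n =
        (\<Sum>j\<in>?I. ?b 1 j * (stage E (?pr j) k l n \<bullet> ?G j)) + (\<Sum>i\<in>?I. ?b 2 i * (?F i \<bullet> stage H' (?pr i) k l n))"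
    proof (rule bilinear_PRK_conservation[OF B, where \<alpha> = "?a 2" and \<alpha>' = "?a 1"])
      show "t1 E k l n = t0 E k l n + (\<Sum>i\<in>?I. ?b 2 i *\<^sub>R ?F i)"
        using E_eq by (simp add: sum.Plus scaleR_sum_right sum_negf mult.commute)
      show "t1 H' k l n = t0 H' k l n + (\<Sum>i\<in>?I. ?b 1 i *\<^sub>R ?G i)"
        using H_eq by (simp add: sum.Plus scaleR_sum_right sum_negf mult.commute)
      show "stage E (?pr j) k l n = t0 E k l n + (\<Sum>i\<in>?I. ?a 2 j i *\<^sub>R ?F i)" if "j \<in> ?I" for j
      proof -
        have "?pr j \<in> {1..r}" using that by auto
        then show ?thesis
          using E_eq by (simp add: sum.Plus scaleR_sum_right sum_negf mult.commute)
      qed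
      show "stage H' (?pr j) k l n = t0 H' k l n + (\<Sum>i\<in>?I. ?a 1 j i *\<^sub>R ?G i)" if "j \<in> ?I" for j
      proof -
        have "?pr j \<in> {1..r}" using that by auto
        then show ?thesis
          using H_eq by (simp add: sum.Plus scaleR_sum_right sum_negf mult.commute)
      qed
      \<comment> \<open>Each of \<open>i\<close> and \<open>j\<close> is a drift or a noise index,
        and the four combinations are the four assumed conditions. A stage depends only on the
        underlying number, hence \<open>?pr\<close> in the rows of \<open>?a\<close>.\<close>
      show "?a 2 j i * ?b 1 j + ?b 2 i * ?a 1 i j - ?b 2 i * ?b 1 j = 0" if "i \<in> ?I" "j \<in> ?I" for i j
        using that sympl by auto
    qed auto
    \<comment> \<open>The update of \<open>E\<close> weights its drift with \<open>tb 2\<close>,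
      that of \<open>H'\<close> with \<open>tb 1\<close>; the law needs one common weight.\<close>
    moreover have "(\<Sum>m=1..r. tb 2 m * (\<Delta>t * (discrete_curl H m k l n \<bullet> stage H' m k l n))) =
        (\<Sum>m=1..r. tb 1 m * (\<Delta>t * (discrete_curl H m k l n \<bullet> stage H' m k l n)))"
      using tb by (auto intro!: sum.cong)
    ultimately show ?thesis
      by (simp add: sum.Plus sum.distrib sum_subtractf sum_negf sum_distrib_left algebra_simps
          del: One_nat_def)
  qed
  show ?thesis
    using main[OF rel] main[OF rel(2,1)]
    by (simp add: curl_pairing_def sum.distrib sum_subtractf sum_negf sum_distrib_left algebra_simps inner_commute)
qed

section \<open>Flux differences in the three space directions\<close>

text \<open>The matrix and the record selector are arguments so that one definition serves all three
  directions.\<close>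

definition dir_pairing ::
  "real ^ 3 ^ 3 \<Rightarrow> (cell_field \<Rightarrow> nat \<Rightarrow> nat \<Rightarrow> nat \<Rightarrow> nat \<Rightarrow> real ^ 3) \<Rightarrow> cell_field \<Rightarrow> cell_field \<Rightarrow>
    nat \<Rightarrow> nat \<Rightarrow> nat \<Rightarrow> nat \<Rightarrow> real" where
  "dir_pairing A del F G m k l n =
    stage F m k l n \<bullet> (A *v del G m k l n) - stage G m k l n \<bullet> (A *v del F m k l n)"

lemma curl_pairing_split:
  "curl_pairing F G m k l n =
    dir_pairing D1 delx F G m k l n + dir_pairing D2 dely F G m k l n + dir_pairing D3 delz F G m k l n"
  by (simp add: curl_pairing_def dir_pairing_def discrete_curl_def inner_add_right)

text \<open>In each direction the other two stage indices are frozen, and along the remaining one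
  the relations form an ordinary Runge--Kutta step.\<close>

lemma spatial_relations_conservation:
  assumes F: "spatial_relations s r \<Delta>x \<Delta>y \<Delta>z ax bx ay by az bz F"
    and G: "spatial_relations s r \<Delta>x \<Delta>y \<Delta>z ax bx ay by az bz G"
    and sx: "symplectic_coeffs s ax bx"
    and sy: "symplectic_coeffs s ay by"
    and sz: "symplectic_coeffs s az bz"
    and m: "m \<in> {1..r}" and ij: "i \<in> {1..s}" "j \<in> {1..s}"
  shows "x1 F m i j \<bullet> (D1 *v x1 G m i j) - x0 F m i j \<bullet> (D1 *v x0 G m i j) =
      \<Delta>x * (\<Sum>k=1..s. bx k * dir_pairing D1 delx F G m k i j)"
    and "y1 F m i j \<bullet> (D2 *v y1 G m i j) - y0 F m i j \<bullet> (D2 *v y0 G m i j) =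
      \<Delta>y * (\<Sum>l=1..s. by l * dir_pairing D2 dely F G m i l j)"
    and "z1 F m i j \<bullet> (D3 *v z1 G m i j) - z0 F m i j \<bullet> (D3 *v z0 G m i j) =
      \<Delta>z * (\<Sum>n=1..s. bz n * dir_pairing D3 delz F G m i j n)"
  unfolding dir_pairing_def
proof -
  note rel = F[unfolded spatial_relations_def, rule_format, OF m]
    G[unfolded spatial_relations_def, rule_format, OF m]
  show "x1 F m i j \<bullet> (D1 *v x1 G m i j) - x0 F m i j \<bullet> (D1 *v x0 G m i j) =
      \<Delta>x * (\<Sum>k=1..s. bx k * (stage F m k i j \<bullet> (D1 *v delx G m k i j) - stage G m k i j \<bullet> (D1 *v delx F m k i j)))"
    \<comment> \<open>The relation for the far boundary value is quantified also over the stage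
      index along its own direction, which it does not mention; an index in range such as
      \<open>i\<close> supplies an instance.\<close>
    by (rule spatial_RK_conservation[OF curl_component_D1, where a = ax])
      (use rel sx ij in blast)+
  show "y1 F m i j \<bullet> (D2 *v y1 G m i j) - y0 F m i j \<bullet> (D2 *v y0 G m i j) =
      \<Delta>y * (\<Sum>l=1..s. by l * (stage F m i l j \<bullet> (D2 *v dely G m i l j) - stage G m i l j \<bullet> (D2 *v dely F m i l j)))"
    by (rule spatial_RK_conservation[OF curl_component_D2, where a = ay])
      (use rel sy ij in blast)+
  show "z1 F m i j \<bullet> (D3 *v z1 G m i j) - z0 F m i j \<bullet> (D3 *v z0 G m i j) =
      \<Delta>z * (\<Sum>n=1..s. bz n * (stage F m i j n \<bullet> (D3 *v delz G m i j n) - stage G m i j n \<bullet> (D3 *v delz F m i j n)))"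
    by (rule spatial_RK_conservation[OF curl_component_D3, where a = az])
      (use rel sz ij in blast)+
qed

text \<open>For skew \<open>A\<close> the two halves of the antisymmetrization agree. The resulting
  factor 2 is what the halves in front of the spatial terms of the law compensate.\<close>

lemma wedge_mat_stack_curl:
  assumes "curl_component A"
    and "(X has_derivative X') (at \<theta>)" "(Y has_derivative Y') (at \<theta>)"
  shows "wedge_mat (block_diag A) (\<lambda>\<theta>'. stack (X \<theta>') (Y \<theta>')) \<theta> \<xi> \<eta> =
    2 * (X' \<xi> \<bullet> (A *v X' \<eta>) + Y' \<xi> \<bullet> (A *v Y' \<eta>))"
proof -
  have "x \<bullet> (A *v y) = - (y \<bullet> (A *v x))" for x y
    using curl_component_inner(1)[OF assms(1), of x y] by (simp add: inner_commute)
  from this[of "X' \<eta>" "X' \<xi>"] this[of "Y' \<eta>" "Y' \<xi>"] show ?thesis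
    by (simp add: wedge_mat_stack_eq_inner[OF assms(2,3)])
qed

text \<open>Each flux difference is a sum over the stage index of its own direction, so that index
  has to become innermost and the temporal one outermost. The four sets are distinct variables so
  that rewriting with \<open>sum.swap\<close> at a chosen set is directed; the theorem takes three
  of them equal.\<close>

lemma sum_swap_4:
  fixes f :: "'a \<Rightarrow> 'b \<Rightarrow> 'c \<Rightarrow> 'd \<Rightarrow> 'e::comm_monoid_add"
  shows "(\<Sum>k\<in>A. \<Sum>l\<in>B. \<Sum>n\<in>C. \<Sum>m\<in>D. f k l n m) = (\<Sum>m\<in>D. \<Sum>l\<in>B. \<Sum>n\<in>C. \<Sum>k\<in>A. f k l n m)"
    and "(\<Sum>k\<in>A. \<Sum>l\<in>B. \<Sum>n\<in>C. \<Sum>m\<in>D. f k l n m) = (\<Sum>m\<in>D. \<Sum>k\<in>A. \<Sum>n\<in>C. \<Sum>l\<in>B. f k l n m)"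
    and "(\<Sum>k\<in>A. \<Sum>l\<in>B. \<Sum>n\<in>C. \<Sum>m\<in>D. f k l n m) = (\<Sum>m\<in>D. \<Sum>k\<in>A. \<Sum>l\<in>B. \<Sum>n\<in>C. f k l n m)"
proof -
  show 1: "(\<Sum>k\<in>A. \<Sum>l\<in>B. \<Sum>n\<in>C. \<Sum>m\<in>D. f k l n m) = (\<Sum>m\<in>D. \<Sum>k\<in>A. \<Sum>l\<in>B. \<Sum>n\<in>C. f k l n m)"
    by (simp only: sum.swap[of _ D])
  show "(\<Sum>k\<in>A. \<Sum>l\<in>B. \<Sum>n\<in>C. \<Sum>m\<in>D. f k l n m) = (\<Sum>m\<in>D. \<Sum>l\<in>B. \<Sum>n\<in>C. \<Sum>k\<in>A. f k l n m)"
    unfolding 1 by (simp only: sum.swap[of _ _ A])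
  show "(\<Sum>k\<in>A. \<Sum>l\<in>B. \<Sum>n\<in>C. \<Sum>m\<in>D. f k l n m) = (\<Sum>m\<in>D. \<Sum>k\<in>A. \<Sum>n\<in>C. \<Sum>l\<in>B. f k l n m)"
    unfolding 1 by (simp only: sum.swap[of _ _ B])
qed

section \<open>Assembly of the discrete conservation law\<close>

theorem mainTheorem9:
  fixes M :: "'w measure"
    and D :: "(real ^ 3) set"
    and Q :: "(real ^ 3 \<Rightarrow> real) \<Rightarrow> (real ^ 3 \<Rightarrow> real)"
    and W :: "real \<Rightarrow> 'w \<Rightarrow> real ^ 3 \<Rightarrow> real"
    and pt :: "nat \<Rightarrow> nat \<Rightarrow> nat \<Rightarrow> real ^ 3"
    and s r :: nat
    and lam \<Delta>x \<Delta>y \<Delta>z \<Delta>t :: real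
    and a :: "nat \<Rightarrow> nat \<Rightarrow> nat \<Rightarrow> real" and b :: "nat \<Rightarrow> nat \<Rightarrow> real"
    and ta :: "nat \<Rightarrow> nat \<Rightarrow> nat \<Rightarrow> real" and tb :: "nat \<Rightarrow> nat \<Rightarrow> real"
    and ba :: "nat \<Rightarrow> nat \<Rightarrow> nat \<Rightarrow> real" and bb :: "nat \<Rightarrow> nat \<Rightarrow> real"
    and \<Theta> :: "'p::real_normed_vector set"
    and H E :: "'w \<Rightarrow> 'p \<Rightarrow> cell_field"
  assumes "prob_space M"
    and "D \<in> sets borel"
    and "Q_Wiener_process M D Q W"
    and "\<And>k l n. \<lbrakk>k \<in> {1..s}; l \<in> {1..s}; n \<in> {1..s}\<rbrakk> \<Longrightarrow> pt k l n \<in> D"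
    and "s \<ge> 1" and "r \<ge> 1"
    and "\<Delta>x > 0" and "\<Delta>y > 0" and "\<Delta>z > 0" and "\<Delta>t > 0"
    and "open \<Theta>"
    and smooth: "AE \<omega> in M. \<forall>\<theta>\<in>\<Theta>.
          differentiable_field s r (H \<omega>) \<theta> \<and> differentiable_field s r (E \<omega>) \<theta>"
    and scheme: "AE \<omega> in M. \<forall>\<theta>\<in>\<Theta>.
          maxwell_PRK s r lam \<Delta>x \<Delta>y \<Delta>z \<Delta>t
            (\<lambda>k l n. W \<Delta>t \<omega> (pt k l n) - W 0 \<omega> (pt k l n))
            a b ta tb ba bb (H \<omega> \<theta>) (E \<omega> \<theta>)"
    and "\<And>i m. \<lbrakk>i \<in> {1..r}; m \<in> {1..r}\<rbrakk> \<Longrightarrow>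
          ta 2 m i * tb 1 m + tb 2 i * ta 1 i m - tb 2 i * tb 1 m = 0"
    and "\<And>i m. \<lbrakk>i \<in> {1..r}; m \<in> {1..r}\<rbrakk> \<Longrightarrow>
          ba 2 m i * tb 1 m + bb 2 i * ta 1 i m - bb 2 i * tb 1 m = 0"
    and "\<And>i m. \<lbrakk>i \<in> {1..r}; m \<in> {1..r}\<rbrakk> \<Longrightarrow>
          ta 2 m i * bb 1 m + tb 2 i * ba 1 i m - tb 2 i * bb 1 m = 0"
    and "\<And>i m. \<lbrakk>i \<in> {1..r}; m \<in> {1..r}\<rbrakk> \<Longrightarrow>
          ba 2 m i * bb 1 m + bb 2 i * ba 1 i m - bb 2 i * bb 1 m = 0"
    and "\<And>L j k. \<lbrakk>L \<in> {1..6}; j \<in> {1..s}; k \<in> {1..s}\<rbrakk> \<Longrightarrow>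
          a L k j * b L k + b L j * a L j k - b L j * b L k = 0"
    and "\<And>k. k \<in> {1..s} \<Longrightarrow> b 1 k = b 4 k"
    and "\<And>k. k \<in> {1..s} \<Longrightarrow> b 2 k = b 5 k"
    and "\<And>k. k \<in> {1..s} \<Longrightarrow> b 3 k = b 6 k"
    and "\<And>m. m \<in> {1..r} \<Longrightarrow> tb 1 m = tb 2 m"
  shows "AE \<omega> in M. \<forall>\<theta>\<in>\<Theta>. \<forall>\<xi> \<eta>.
      1 / \<Delta>t * (\<Sum>k=1..s. \<Sum>l=1..s. \<Sum>n=1..s. b 1 k * b 2 l * b 3 n *
         (wedge_vec (\<lambda>\<theta>'. t1 (E \<omega> \<theta>') k l n) (\<lambda>\<theta>'. t1 (H \<omega> \<theta>') k l n) \<theta> \<xi> \<eta>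
          - wedge_vec (\<lambda>\<theta>'. t0 (E \<omega> \<theta>') k l n) (\<lambda>\<theta>'. t0 (H \<omega> \<theta>') k l n) \<theta> \<xi> \<eta>))
    + 1 / (2 * \<Delta>x) * (\<Sum>m=1..r. \<Sum>l=1..s. \<Sum>n=1..s. tb 1 m * b 2 l * b 3 n *
         (wedge_mat K1 (\<lambda>\<theta>'. stack (x1 (H \<omega> \<theta>') m l n) (x1 (E \<omega> \<theta>') m l n)) \<theta> \<xi> \<eta>
          - wedge_mat K1 (\<lambda>\<theta>'. stack (x0 (H \<omega> \<theta>') m l n) (x0 (E \<omega> \<theta>') m l n)) \<theta> \<xi> \<eta>))
    + 1 / (2 * \<Delta>y) * (\<Sum>m=1..r. \<Sum>k=1..s. \<Sum>n=1..s. tb 1 m * b 1 k * b 3 n *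
         (wedge_mat K2 (\<lambda>\<theta>'. stack (y1 (H \<omega> \<theta>') m k n) (y1 (E \<omega> \<theta>') m k n)) \<theta> \<xi> \<eta>
          - wedge_mat K2 (\<lambda>\<theta>'. stack (y0 (H \<omega> \<theta>') m k n) (y0 (E \<omega> \<theta>') m k n)) \<theta> \<xi> \<eta>))
    + 1 / (2 * \<Delta>z) * (\<Sum>m=1..r. \<Sum>k=1..s. \<Sum>l=1..s. tb 1 m * b 1 k * b 2 l *
         (wedge_mat K3 (\<lambda>\<theta>'. stack (z1 (H \<omega> \<theta>') m k l) (z1 (E \<omega> \<theta>') m k l)) \<theta> \<xi> \<eta>
          - wedge_mat K3 (\<lambda>\<theta>'. stack (z0 (H \<omega> \<theta>') m k l) (z0 (E \<omega> \<theta>') m k l)) \<theta> \<xi> \<eta>))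
    = 0"
proof -
  note sT = assms(14-17) and sS = assms(18) and bH = assms(19-21) and tbH = assms(22)
  have sy: "symplectic_coeffs s (a 1) (b 1)" "symplectic_coeffs s (a 2) (b 2)"
      "symplectic_coeffs s (a 3) (b 3)" "symplectic_coeffs s (a 4) (b 4)"
      "symplectic_coeffs s (a 5) (b 5)" "symplectic_coeffs s (a 6) (b 6)"
    unfolding symplectic_coeffs_def by (intro ballI sS; simp)+
  \<comment> \<open>The fluxes of \<open>E\<close> come with the weights \<open>b 4\<close>,
    \<open>b 5\<close>, \<open>b 6\<close>; these identities give both fields the same
    weights.\<close>
  have bsum: "(\<Sum>k=1..s. b 4 k * f k) = (\<Sum>k=1..s. b 1 k * f k)"
      "(\<Sum>k=1..s. b 5 k * f k) = (\<Sum>k=1..s. b 2 k * f k)"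
      "(\<Sum>k=1..s. b 6 k * f k) = (\<Sum>k=1..s. b 3 k * f k)" for f
    using bH by (auto intro!: sum.cong)
  \<comment> \<open>The argument is pathwise: outside one null set, smoothness and the scheme hold
    at every parameter in \<open>\<Theta>\<close> at once.\<close>
  from smooth scheme show ?thesis
  proof eventually_elim
    case (elim \<omega>)
    show ?case
    proof (intro ballI allI, goal_cases)
      case (1 \<theta> \<xi> \<eta>)
      note \<theta> = this
      have dH: "differentiable_field s r (H \<omega>) \<theta>" and dE: "differentiable_field s r (E \<omega>) \<theta>"
        using elim(1) \<theta> by auto
      note d = differentiable_field_has_derivative[OF dH] differentiable_field_has_derivative[OF dE]
      let ?dW = "\<lambda>k l n. W \<Delta>t \<omega> (pt k l n) - W 0 \<omega> (pt k l n)"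
      let ?H = "linearized (H \<omega>) \<theta>" and ?E = "linearized (E \<omega>) \<theta>"
      have lin: "spatial_relations s r \<Delta>x \<Delta>y \<Delta>z (a 1) (b 1) (a 2) (b 2) (a 3) (b 3) (?H v)"
          "spatial_relations s r \<Delta>x \<Delta>y \<Delta>z (a 4) (b 4) (a 5) (b 5) (a 6) (b 6) (?E v)"
          "temporal_relations s r lam \<Delta>t ?dW ta tb ba bb (?H v) (?E v)" for v
        using elim(2)
        by (auto simp: maxwell_PRK_def intro!: linearized_spatial_relations[OF \<open>open \<Theta>\<close> \<theta>]
            linearized_temporal_relations[OF \<open>open \<Theta>\<close> \<theta>] dH dE)
      \<comment> \<open>The contribution of one direction to the wedge pairings at a stage, both
        fields together; it links the time increment \<open>T\<close> to the fluxes
        \<open>X\<close>, \<open>Y\<close>, \<open>Z\<close>.\<close>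
      define c where "c A del m k l n =
        dir_pairing A del (?H \<xi>) (?H \<eta>) m k l n + dir_pairing A del (?E \<xi>) (?E \<eta>) m k l n"
        for A del m k l n
      let ?x = "\<lambda>m k l n. b 1 k * b 2 l * b 3 n * tb 1 m * c D1 delx m k l n"
      let ?y = "\<lambda>m k l n. b 1 k * b 2 l * b 3 n * tb 1 m * c D2 dely m k l n"
      let ?z = "\<lambda>m k l n. b 1 k * b 2 l * b 3 n * tb 1 m * c D3 delz m k l n"
      have T: "wedge_vec (\<lambda>\<theta>'. t1 (E \<omega> \<theta>') k l n) (\<lambda>\<theta>'. t1 (H \<omega> \<theta>') k l n) \<theta> \<xi> \<eta>
          - wedge_vec (\<lambda>\<theta>'. t0 (E \<omega> \<theta>') k l n) (\<lambda>\<theta>'. t0 (H \<omega> \<theta>') k l n) \<theta> \<xi> \<eta> =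
          - \<Delta>t * (\<Sum>m=1..r. tb 1 m * (c D1 delx m k l n + c D2 dely m k l n + c D3 delz m k l n))"
        if i: "k \<in> {1..s}" "l \<in> {1..s}" "n \<in> {1..s}" for k l n
        using temporal_PRK_conservation[OF lin(3)[of \<xi>] lin(3)[of \<eta>] sT tbH i]
        by (simp add: wedge_vec_eq_inner[OF d(24,12)[OF i]] wedge_vec_eq_inner[OF d(23,11)[OF i]]
            curl_pairing_split c_def add_ac)
      note sp = spatial_relations_conservation[OF lin(1)[of \<xi>] lin(1)[of \<eta>] sy(1-3)]
        spatial_relations_conservation[OF lin(2)[of \<xi>] lin(2)[of \<eta>] sy(4-6)]
      have X: "wedge_mat K1 (\<lambda>\<theta>'. stack (x1 (H \<omega> \<theta>') m l n) (x1 (E \<omega> \<theta>') m l n)) \<theta> \<xi> \<eta>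
          - wedge_mat K1 (\<lambda>\<theta>'. stack (x0 (H \<omega> \<theta>') m l n) (x0 (E \<omega> \<theta>') m l n)) \<theta> \<xi> \<eta> =
          2 * \<Delta>x * (\<Sum>k=1..s. b 1 k * c D1 delx m k l n)"
        if i: "m \<in> {1..r}" "l \<in> {1..s}" "n \<in> {1..s}" for m l n
        using sp(1,4)[OF i]
        \<comment> \<open>Deleting \<open>One_nat_def\<close> keeps the literal \<open>1\<close> in
          which \<open>bsum\<close> is stated.\<close>
        by (simp add: K1_def wedge_mat_stack_curl[OF curl_component_D1 d(5,17)[OF i]]
            wedge_mat_stack_curl[OF curl_component_D1 d(6,18)[OF i]] c_def bsum
            distrib_left sum.distrib del: One_nat_def)
      have Y: "wedge_mat K2 (\<lambda>\<theta>'. stack (y1 (H \<omega> \<theta>') m k n) (y1 (E \<omega> \<theta>') m k n)) \<theta> \<xi> \<eta>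
          - wedge_mat K2 (\<lambda>\<theta>'. stack (y0 (H \<omega> \<theta>') m k n) (y0 (E \<omega> \<theta>') m k n)) \<theta> \<xi> \<eta> =
          2 * \<Delta>y * (\<Sum>l=1..s. b 2 l * c D2 dely m k l n)"
        if i: "m \<in> {1..r}" "k \<in> {1..s}" "n \<in> {1..s}" for m k n
        using sp(2,5)[OF i]
        by (simp add: K2_def wedge_mat_stack_curl[OF curl_component_D2 d(7,19)[OF i]]
            wedge_mat_stack_curl[OF curl_component_D2 d(8,20)[OF i]] c_def bsum
            distrib_left sum.distrib del: One_nat_def)
      have Z: "wedge_mat K3 (\<lambda>\<theta>'. stack (z1 (H \<omega> \<theta>') m k l) (z1 (E \<omega> \<theta>') m k l)) \<theta> \<xi> \<eta>
          - wedge_mat K3 (\<lambda>\<theta>'. stack (z0 (H \<omega> \<theta>') m k l) (z0 (E \<omega> \<theta>') m k l)) \<theta> \<xi> \<eta> =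
          2 * \<Delta>z * (\<Sum>n=1..s. b 3 n * c D3 delz m k l n)"
        if i: "m \<in> {1..r}" "k \<in> {1..s}" "l \<in> {1..s}" for m k l
        using sp(3,6)[OF i]
        by (simp add: K3_def wedge_mat_stack_curl[OF curl_component_D3 d(9,21)[OF i]]
            wedge_mat_stack_curl[OF curl_component_D3 d(10,22)[OF i]] c_def bsum
            distrib_left sum.distrib del: One_nat_def)
      have "1 / \<Delta>t * (\<Sum>k=1..s. \<Sum>l=1..s. \<Sum>n=1..s. b 1 k * b 2 l * b 3 n *
         (wedge_vec (\<lambda>\<theta>'. t1 (E \<omega> \<theta>') k l n) (\<lambda>\<theta>'. t1 (H \<omega> \<theta>') k l n) \<theta> \<xi> \<eta>
          - wedge_vec (\<lambda>\<theta>'. t0 (E \<omega> \<theta>') k l n) (\<lambda>\<theta>'. t0 (H \<omega> \<theta>') k l n) \<theta> \<xi> \<eta>)) =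
        - (\<Sum>k=1..s. \<Sum>l=1..s. \<Sum>n=1..s. \<Sum>m=1..r. ?x m k l n + ?y m k l n + ?z m k l n)"
        using \<open>\<Delta>t > 0\<close>
        \<comment> \<open>The congruence rule supplies the index ranges that the premises of
          \<open>T\<close> ask for; the factor \<open>\<Delta>t\<close> then cancels.\<close>
        by (simp only: T cong: sum.cong)
          (simp add: sum_distrib_left sum_negf[symmetric] algebra_simps)
      also have "\<dots> = - (\<Sum>m=1..r. \<Sum>l=1..s. \<Sum>n=1..s. \<Sum>k=1..s. ?x m k l n)
          - (\<Sum>m=1..r. \<Sum>k=1..s. \<Sum>n=1..s. \<Sum>l=1..s. ?y m k l n)
          - (\<Sum>m=1..r. \<Sum>k=1..s. \<Sum>l=1..s. \<Sum>n=1..s. ?z m k l n)"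
        using sum_swap_4(1)[of "\<lambda>k l n m. ?x m k l n" "{1..r}" "{1..s}" "{1..s}" "{1..s}"]
          sum_swap_4(2)[of "\<lambda>k l n m. ?y m k l n" "{1..r}" "{1..s}" "{1..s}" "{1..s}"]
          sum_swap_4(3)[of "\<lambda>k l n m. ?z m k l n" "{1..r}" "{1..s}" "{1..s}" "{1..s}"]
        by (simp only: sum.distrib)
      also have "(\<Sum>m=1..r. \<Sum>l=1..s. \<Sum>n=1..s. \<Sum>k=1..s. ?x m k l n) =
        1 / (2 * \<Delta>x) * (\<Sum>m=1..r. \<Sum>l=1..s. \<Sum>n=1..s. tb 1 m * b 2 l * b 3 n *
         (wedge_mat K1 (\<lambda>\<theta>'. stack (x1 (H \<omega> \<theta>') m l n) (x1 (E \<omega> \<theta>') m l n)) \<theta> \<xi> \<eta>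
          - wedge_mat K1 (\<lambda>\<theta>'. stack (x0 (H \<omega> \<theta>') m l n) (x0 (E \<omega> \<theta>') m l n)) \<theta> \<xi> \<eta>))"
        using \<open>\<Delta>x > 0\<close> by (simp only: X cong: sum.cong) (simp add: sum_distrib_left mult_ac)
      also have "(\<Sum>m=1..r. \<Sum>k=1..s. \<Sum>n=1..s. \<Sum>l=1..s. ?y m k l n) =
        1 / (2 * \<Delta>y) * (\<Sum>m=1..r. \<Sum>k=1..s. \<Sum>n=1..s. tb 1 m * b 1 k * b 3 n *
         (wedge_mat K2 (\<lambda>\<theta>'. stack (y1 (H \<omega> \<theta>') m k n) (y1 (E \<omega> \<theta>') m k n)) \<theta> \<xi> \<eta>
          - wedge_mat K2 (\<lambda>\<theta>'. stack (y0 (H \<omega> \<theta>') m k n) (y0 (E \<omega> \<theta>') m k n)) \<theta> \<xi> \<eta>))"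
        using \<open>\<Delta>y > 0\<close> by (simp only: Y cong: sum.cong) (simp add: sum_distrib_left mult_ac)
      also have "(\<Sum>m=1..r. \<Sum>k=1..s. \<Sum>l=1..s. \<Sum>n=1..s. ?z m k l n) =
        1 / (2 * \<Delta>z) * (\<Sum>m=1..r. \<Sum>k=1..s. \<Sum>l=1..s. tb 1 m * b 1 k * b 2 l *
         (wedge_mat K3 (\<lambda>\<theta>'. stack (z1 (H \<omega> \<theta>') m k l) (z1 (E \<omega> \<theta>') m k l)) \<theta> \<xi> \<eta>
          - wedge_mat K3 (\<lambda>\<theta>'. stack (z0 (H \<omega> \<theta>') m k l) (z0 (E \<omega> \<theta>') m k l)) \<theta> \<xi> \<eta>))"
        using \<open>\<Delta>z > 0\<close> by (simp only: Z cong: sum.cong) (simp add: sum_distrib_left mult_ac)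
      finally show ?case by simp
    qed
  qed
qed

end
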